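(* Let $(K,v)$ be a valued field with value group $\Gamma_v$, let $\Lambda$ be a totally ordered abelian group containing the divisible hull $\Gamma_{\mathbb{Q}}=\Gamma_v\otimes_{\mathbb{Z}}\mathbb{Q}$, and let $\mathfrak{v}=\{\nu_i\}_{i\in I}\subset\mathcal{T}=\mathcal{T}(v,\Lambda)$ be an increasing family of valuations admitting a supremum $\sup_{i\in I}\nu_i$ in $\mathcal{T}$. Then $\lim_{i\in I}\nu_i=\sup_{i\in I}\nu_i$ when $\mathcal{T}$ is considered with the weak tree topology; that is, $\sup_{i\in I}\nu_i$ is a limit of $\{\nu_i\}_{i\in I}$ in this topology and it is the only one.
   Context: A valuation on $K[x]$ is a map $\nu:K[x]\to\Lambda_\infty=\Lambda\cup\{\infty\}$ with $\nu(fg)=\nu(f)+\nu(g)$, $\nu(f+g)\geq\min\{\nu(f),\nu(g)\}$, $\nu(1)=0$, $\nu(0)=\infty$ (nonzero polynomials may have value $\infty$). $\mathcal{T}(v,\Lambda)$ is the set of valuations $\nu:K[x]\to\Lambda_\infty$ with $\nu|_K=v$, partially ordered by $\mu\leq\nu$ iff $\mu(f)\leq\nu(f)$ for all $f\in K[x]$. Known facts: each $(-\infty,\mu]=\{\nu\in\mathcal{T}\mid\nu\leq\mu\}$ is totally ordered, and any $\mu,\nu\in\mathcal{T}$ have an infimum $\mu\wedge\nu\in\mathcal{T}$. Interval: $[\mu,\nu]=\{\eta\in\mathcal{T}\mid\mu\wedge\nu\leq\eta\leq\mu\text{ or }\mu\wedge\nu\leq\eta\leq\nu\}$. For $\mu\in\mathcal{T}$,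 on $\mathcal{T}\setminus\{\mu\}$ let $\nu\sim_\mu\eta$ iff $\mu\notin[\nu,\eta]$ (an equivalence relation), with classes $[\nu]_\mu$. The weak tree topology is the topology on $\mathcal{T}$ generated by all sets $[\nu]_\mu$, $\mu\in\mathcal{T}$, $\nu\in\mathcal{T}\setminus\{\mu\}$. An increasing family of valuations is a (non-empty) totally ordered subset $\{\nu_i\}_{i\in I}$ of $\mathcal{T}$ without maximum; the index set $I$ is totally ordered so that $i<j$ iff $\nu_i<\nu_j$. A supremum of it is an element $\mu\in\mathcal{T}$ with $\nu_i\leq\mu$ for all $i\in I$ and such that any $\mu'\in\mathcal{T}$ with $\nu_i\leq\mu'$ for all $i\in I$ and $\mu'\leq\mu$ equals $\mu$; such an element is unique if it exists, and is denoted $\sup_{i\in I}\nu_i$. A point $y$ of a topological space $Y$ is a limit of a family $\{y_i\}_{i\in I}$ indexed by a directed set $I$ if for every open neighbourhood $U$ of $y$ there is $i_0\in I$ with $y_j\in U$ for all $j\geq i_0$. The notation $\lim_{i\in I}y_i=y$ means that $y$ is the only limit of the family. *)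

theory Defs
  imports
    "HOL-Analysis.Analysis"
    "HOL-Computational_Algebra.Polynomial"
    "HOL-Library.Lattice_Constructions"
begin

text \<open>
  For an ordered abelian group \<open>'l\<close>, the type \<open>'l top\<close> (with constructors \<open>top.Value\<close> and
  \<open>top.Top\<close>) is \<open>'l\<close> with a largest element \<open>\<infinity>\<close> added. Addition is extended to it so that \<open>\<infinity>\<close>
  is absorbing.
\<close>

instantiation top :: (comm_monoid_add) comm_monoid_add
begin

definition zero_top :: "'a top" where
  "0 = top.Value 0"

definition plus_top :: "'a top \<Rightarrow> 'a top \<Rightarrow> 'a top" where
  "x + y = (case x of top.Top \<Rightarrow> top.Top
    | top.Value a \<Rightarrow> (case y of top.Top \<Rightarrow> top.Top | top.Value b \<Rightarrow> top.Value (a + b)))"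

instance
  by standard (auto simp: zero_top_def plus_top_def add_ac split: top.splits)

end

text \<open>Nonzero elements are allowed to have value \<open>\<infinity>\<close>.\<close>

definition valuation :: "('a::comm_ring_1 \<Rightarrow> 'l::linordered_ab_group_add top) \<Rightarrow> bool" where
  "valuation \<nu> \<longleftrightarrow>
     (\<forall>f g. \<nu> (f * g) = \<nu> f + \<nu> g) \<and>
     (\<forall>f g. \<nu> (f + g) \<ge> min (\<nu> f) (\<nu> g)) \<and>
     \<nu> 1 = 0 \<and> \<nu> 0 = top.Top"

text \<open>On a field, a map as above is a valuation in the usual, stricter sense.\<close>

lemma valuation_field_eq_Top_iff:
  fixes v :: "'k::field \<Rightarrow> 'l::linordered_ab_group_add top"
  assumes "valuation v"
  shows "v a = top.Top \<longleftrightarrow> a = 0"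
proof
  show "a = 0" if "v a = top.Top"
  proof (rule ccontr)
    assume "a \<noteq> 0"
    then have "v 1 = v a + v (inverse a)"
      using assms unfolding valuation_def by (metis right_inverse)
    then show False
      using assms that by (simp add: valuation_def zero_top_def plus_top_def)
  qed
  show "v a = top.Top" if "a = 0"
    using assms that by (simp add: valuation_def)
qed

definition value_group :: "('k::field \<Rightarrow> 'l::linordered_ab_group_add top) \<Rightarrow> 'l set" where
  "value_group v = {\<gamma>. \<exists>a. a \<noteq> 0 \<and> v a = top.Value \<gamma>}"

definition nat_multiple :: "nat \<Rightarrow> 'l::comm_monoid_add \<Rightarrow> 'l" where
  "nat_multiple n x = (\<Sum>i<n. x)"

text \<open>
  \<open>H\<close> is a divisible hull of the subgroup \<open>G\<close>: a divisible group containing \<open>G\<close> in which every element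
  has a positive multiple in \<open>G\<close>. Since an ordered group is torsion-free, such an \<open>H\<close> is
  \<open>G \<otimes> \<rat>\<close>, with \<open>\<gamma> \<otimes> (m/n)\<close> corresponding to the unique \<open>\<delta>\<close> such that \<open>n\<delta> = m\<gamma>\<close>; its ordering is
  the only one compatible with that of \<open>G\<close>.
\<close>

definition is_divisible_hull :: "'l::linordered_ab_group_add set \<Rightarrow> 'l set \<Rightarrow> bool" where
  "is_divisible_hull G H \<longleftrightarrow>
     0 \<in> H \<and> (\<forall>x\<in>H. \<forall>y\<in>H. x - y \<in> H) \<and>
     (\<forall>x\<in>H. \<forall>n>0. \<exists>y\<in>H. nat_multiple n y = x) \<and>
     G \<subseteq> H \<and> (\<forall>x\<in>H. \<exists>n>0. nat_multiple n x \<in> G)"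

text \<open>
  The set \<open>\<T>(v, \<Lambda>)\<close>, where \<open>\<Lambda>\<close> is the type \<open>'l\<close>. Its partial order is the pointwise order \<open>\<le>\<close> on
  functions.
\<close>

definition val_tree ::
    "('k::field \<Rightarrow> 'l::linordered_ab_group_add top) \<Rightarrow> ('k poly \<Rightarrow> 'l top) set" where
  "val_tree v = {\<nu>. valuation \<nu> \<and> (\<forall>a. \<nu> [:a:] = v a)}"

definition meet :: "'a::order set \<Rightarrow> 'a \<Rightarrow> 'a \<Rightarrow> 'a" where
  "meet T \<mu> \<nu> = (GREATEST \<eta>. \<eta> \<in> T \<and> \<eta> \<le> \<mu> \<and> \<eta> \<le> \<nu>)"

definition tree_interval :: "'a::order set \<Rightarrow> 'a \<Rightarrow> 'a \<Rightarrow> 'a set" where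
  "tree_interval T \<mu> \<nu> =
     {\<eta> \<in> T. meet T \<mu> \<nu> \<le> \<eta> \<and> \<eta> \<le> \<mu> \<or> meet T \<mu> \<nu> \<le> \<eta> \<and> \<eta> \<le> \<nu>}"

text \<open>The class \<open>[\<nu>]\<^sub>\<mu>\<close>, for \<open>\<nu> \<noteq> \<mu>\<close>.\<close>

definition tangent_class :: "'a::order set \<Rightarrow> 'a \<Rightarrow> 'a \<Rightarrow> 'a set" where
  "tangent_class T \<mu> \<nu> = {\<eta> \<in> T - {\<mu>}. \<mu> \<notin> tree_interval T \<nu> \<eta>}"

text \<open>
  The underlying set \<open>T\<close> is added to the generating sets because \<open>topology_generated_by\<close> takes their
  union as the space, and there are no classes when \<open>T\<close> has only one point.
\<close>

definition weak_tree_topology :: "'a::order set \<Rightarrow> 'a topology" where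
  "weak_tree_topology T =
     topology_generated_by (insert T {tangent_class T \<mu> \<nu> | \<mu> \<nu>. \<mu> \<in> T \<and> \<nu> \<in> T - {\<mu>}})"

text \<open>\<open>r\<close> is the (reflexive) ordering of the index set \<open>I\<close>.\<close>

definition increasing_family ::
    "'a::order set \<Rightarrow> 'i set \<Rightarrow> 'i rel \<Rightarrow> ('i \<Rightarrow> 'a) \<Rightarrow> bool" where
  "increasing_family T I r \<nu> \<longleftrightarrow>
     I \<noteq> {} \<and> linear_order_on I r \<and> \<nu> ` I \<subseteq> T \<and>
     (\<forall>i\<in>I. \<forall>j\<in>I. (i, j) \<in> r \<and> i \<noteq> j \<longleftrightarrow> \<nu> i < \<nu> j) \<and>
     \<not> (\<exists>i\<in>I. \<forall>j\<in>I. \<nu> j \<le> \<nu> i)"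

text \<open>A supremum is required to be a minimal upper bound, not necessarily a least one.\<close>

definition is_supremum :: "'a::order set \<Rightarrow> 'i set \<Rightarrow> ('i \<Rightarrow> 'a) \<Rightarrow> 'a \<Rightarrow> bool" where
  "is_supremum T I \<nu> \<mu> \<longleftrightarrow>
     \<mu> \<in> T \<and> (\<forall>i\<in>I. \<nu> i \<le> \<mu>) \<and>
     (\<forall>\<mu>'\<in>T. (\<forall>i\<in>I. \<nu> i \<le> \<mu>') \<and> \<mu>' \<le> \<mu> \<longrightarrow> \<mu>' = \<mu>)"

text \<open>
  The filter of tails of a set \<open>I\<close> directed by \<open>r\<close>. The lemma below shows that \<open>limitin\<close> along it is
  the usual notion of limit of a family indexed by \<open>I\<close>.
\<close>

definition tails :: "'i set \<Rightarrow> 'i rel \<Rightarrow> 'i filter" where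
  "tails I r = (INF i\<in>I. principal {j \<in> I. (i, j) \<in> r})"

lemma limitin_tails_iff:
  assumes "I \<noteq> {}" "linear_order_on I r"
  shows "limitin X f y (tails I r) \<longleftrightarrow>
    y \<in> topspace X \<and>
    (\<forall>U. openin X U \<and> y \<in> U \<longrightarrow> (\<exists>i\<in>I. \<forall>j\<in>I. (i, j) \<in> r \<longrightarrow> f j \<in> U))"
proof -
  have dir: "\<exists>k\<in>I. {l \<in> I. (k, l) \<in> r} \<subseteq> {l \<in> I. (i, l) \<in> r} \<inter> {l \<in> I. (j, l) \<in> r}"
    if "i \<in> I" "j \<in> I" for i j
  proof -
    have tr: "trans r" and "refl_on I r" "total_on I r"
      using assms(2) by (auto simp: order_on_defs)
    then have "(i, j) \<in> r \<or> (j, i) \<in> r"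
      using that by (metis refl_onD total_on_def)
    then show ?thesis
      using that by (auto dest: transD[OF tr])
  qed
  have "eventually P (tails I r) \<longleftrightarrow> (\<exists>i\<in>I. \<forall>j\<in>I. (i, j) \<in> r \<longrightarrow> P j)" for P
    unfolding tails_def
    by (subst eventually_INF_base[OF assms(1)]) (use dir in \<open>auto simp: eventually_principal\<close>)
  then show ?thesis
    by (simp add: limitin_def)
qed

definition is_unique_limit ::
    "'a topology \<Rightarrow> 'i set \<Rightarrow> 'i rel \<Rightarrow> ('i \<Rightarrow> 'a) \<Rightarrow> 'a \<Rightarrow> bool" where
  "is_unique_limit X I r f y \<longleftrightarrow>
     limitin X f y (tails I r) \<and> (\<forall>z. limitin X f z (tails I r) \<longrightarrow> z = y)"

end

theory Submission
  imports Defs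
begin

text \<open>
  The topological statement only uses that \<open>\<T>\<close> is a poset in which the sets \<open>(-\<infinity>, \<mu>]\<close> are chains and
  any two elements have an infimum. If \<open>\<eta> < \<sigma> = sup \<nu>\<^sub>i\<close>, then \<open>\<eta> < \<nu>\<^sub>i\<close> eventually, so \<open>\<nu>\<^sub>i\<close> eventually lies on
  the same side of \<open>\<eta>\<close> as \<open>\<sigma>\<close>. A point \<open>z \<noteq> \<sigma>\<close> is separated from a tail of the family by removing
  \<open>\<sigma>\<close> itself when \<open>\<sigma> \<le> z\<close>, and otherwise by removing some \<open>\<nu>\<^sub>i > z \<and> \<sigma>\<close>.

  Both order-theoretic facts come from a polynomial \<open>\<phi>\<close> of least degree on which two valuations differ.
  If \<open>\<mu> < \<nu>\<close>, then \<open>\<mu> (q \<phi> + r) = min (\<mu> q + \<mu> \<phi>) (\<mu> r)\<close> for \<open>deg r < deg \<phi>\<close>, so \<open>\<mu>\<close> is determined by its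
  values in degree below \<open>deg \<phi>\<close> and by \<open>\<mu> \<phi>\<close>; comparing these data shows that elements below \<open>\<nu>\<close> are
  comparable. If \<open>\<nu> \<phi> < \<mu> \<phi>\<close>, without any relation between \<open>\<mu>\<close> and \<open>\<nu>\<close>, then the truncation
  \<open>\<Sum> f\<^sub>s \<phi>\<^sup>s \<mapsto> min\<^sub>s (\<mu> f\<^sub>s + s \<nu> \<phi>)\<close> is a valuation, and it is the infimum of \<open>\<mu>\<close> and \<open>\<nu>\<close>.
\<close>

section \<open>Convergence in abstract trees\<close>

locale meet_tree =
  fixes T :: "'a::order set"
  assumes comparable_below:
      "\<lbrakk>\<mu> \<in> T; \<nu> \<in> T; \<eta> \<in> T; \<mu> \<le> \<eta>; \<nu> \<le> \<eta>\<rbrakk> \<Longrightarrow> \<mu> \<le> \<nu> \<or> \<nu> \<le> \<mu>"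
    and ex_meet:
      "\<lbrakk>\<mu> \<in> T; \<nu> \<in> T\<rbrakk> \<Longrightarrow> \<exists>\<omega>\<in>T. \<omega> \<le> \<mu> \<and> \<omega> \<le> \<nu> \<and> (\<forall>\<eta>\<in>T. \<eta> \<le> \<mu> \<and> \<eta> \<le> \<nu> \<longrightarrow> \<eta> \<le> \<omega>)"
begin

lemma
  assumes "\<mu> \<in> T" "\<nu> \<in> T"
  shows meet_in: "meet T \<mu> \<nu> \<in> T"
    and meet_le1: "meet T \<mu> \<nu> \<le> \<mu>"
    and meet_le2: "meet T \<mu> \<nu> \<le> \<nu>"
    and meet_greatest: "\<lbrakk>\<eta> \<in> T; \<eta> \<le> \<mu>; \<eta> \<le> \<nu>\<rbrakk> \<Longrightarrow> \<eta> \<le> meet T \<mu> \<nu>"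
proof -
  obtain \<omega> where \<omega>: "\<omega> \<in> T" "\<omega> \<le> \<mu>" "\<omega> \<le> \<nu>" "\<forall>\<eta>\<in>T. \<eta> \<le> \<mu> \<and> \<eta> \<le> \<nu> \<longrightarrow> \<eta> \<le> \<omega>"
    using ex_meet[OF assms] by blast
  have "meet T \<mu> \<nu> = \<omega>"
    unfolding meet_def by (rule Greatest_equality) (use \<omega> in auto)
  with \<omega> show "meet T \<mu> \<nu> \<in> T" "meet T \<mu> \<nu> \<le> \<mu>" "meet T \<mu> \<nu> \<le> \<nu>"
    "\<lbrakk>\<eta> \<in> T; \<eta> \<le> \<mu>; \<eta> \<le> \<nu>\<rbrakk> \<Longrightarrow> \<eta> \<le> meet T \<mu> \<nu>"
    by auto
qed

lemma topspace_weak_tree_topology: "topspace (weak_tree_topology T) = T"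
  unfolding weak_tree_topology_def topology_generated_by_topspace
  by (auto simp: tangent_class_def)

lemma openin_tangent_class:
  assumes "\<mu> \<in> T" "\<nu> \<in> T" "\<nu> \<noteq> \<mu>"
  shows "openin (weak_tree_topology T) (tangent_class T \<mu> \<nu>)"
  unfolding weak_tree_topology_def
  by (rule topology_generated_by_Basis) (use assms in blast)

lemma tangent_class_self:
  assumes "\<mu> \<in> T" "\<nu> \<in> T" "\<nu> \<noteq> \<mu>"
  shows "\<nu> \<in> tangent_class T \<mu> \<nu>"
proof -
  have "meet T \<nu> \<nu> = \<nu>"
    using assms(2) by (intro antisym meet_le1 meet_greatest) auto
  then show ?thesis
    using assms by (auto simp: tangent_class_def tree_interval_def)
qed

text \<open>It is enough to test the generating sets: the sets \<open>U\<close> that eventually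
  contain the family whenever they contain \<open>y\<close> are closed under finite intersections
  and arbitrary unions.\<close>

lemma limitin_weak_tree_topologyI:
  assumes "y \<in> T" "\<forall>\<^sub>F i in F. f i \<in> T"
    and sub: "\<And>\<mu> \<nu>. \<lbrakk>\<mu> \<in> T; \<nu> \<in> T; \<nu> \<noteq> \<mu>; y \<in> tangent_class T \<mu> \<nu>\<rbrakk>
      \<Longrightarrow> \<forall>\<^sub>F i in F. f i \<in> tangent_class T \<mu> \<nu>"
  shows "limitin (weak_tree_topology T) f y F"
  unfolding limitin_def
proof (intro conjI allI impI)
  show "y \<in> topspace (weak_tree_topology T)"
    using assms(1) by (simp add: topspace_weak_tree_topology)
next
  fix U assume U: "openin (weak_tree_topology T) U \<and> y \<in> U"
  let ?S = "insert T {tangent_class T \<mu> \<nu> | \<mu> \<nu>. \<mu> \<in> T \<and> \<nu> \<in> T - {\<mu>}}"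
  have "generate_topology_on ?S U"
    using U unfolding weak_tree_topology_def by (auto dest: openin_topology_generated_by)
  then have "y \<in> U \<longrightarrow> (\<forall>\<^sub>F i in F. f i \<in> U)"
  proof induction
    case (Int a b)
    then show ?case by (auto intro: eventually_conj)
  next
    case (UN K)
    then show ?case by (blast intro: eventually_mono)
  next
    case (Basis s)
    then show ?case using assms by auto
  qed simp
  with U show "\<forall>\<^sub>F i in F. f i \<in> U" by blast
qed

end

section \<open>Limits of an increasing family with a supremum\<close>

locale bounded_increasing_family = meet_tree T for T :: "'a::order set" +
  fixes I :: "'i set" and r :: "'i rel" and \<nu> :: "'i \<Rightarrow> 'a" and \<sigma> :: 'a
  assumes increasing: "increasing_family T I r \<nu>"
    and supremum: "is_supremum T I \<nu> \<sigma>"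
begin

lemma family_in: "i \<in> I \<Longrightarrow> \<nu> i \<in> T"
  using increasing by (auto simp: increasing_family_def)

lemma supremum_in: "\<sigma> \<in> T"
  using supremum by (simp add: is_supremum_def)

lemma family_le: "i \<in> I \<Longrightarrow> \<nu> i \<le> \<sigma>"
  using supremum by (simp add: is_supremum_def)

lemma family_mono: "\<lbrakk>i \<in> I; j \<in> I; (i, j) \<in> r\<rbrakk> \<Longrightarrow> \<nu> i \<le> \<nu> j"
  using increasing unfolding increasing_family_def by (metis less_imp_le order_refl)

lemma index_order: "I \<noteq> {}" "linear_order_on I r"
  using increasing by (auto simp: increasing_family_def)

text \<open>An upper bound strictly below \<sigma> would contradict the minimality of \<sigma>. A
  member that is not below \<eta> is still comparable with it, since both lie below
  \<sigma>.\<close>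

lemma ex_family_greater:
  assumes "\<eta> \<in> T" "\<eta> < \<sigma>"
  shows "\<exists>i\<in>I. \<eta> < \<nu> i"
proof -
  obtain i where "i \<in> I" "\<not> \<nu> i \<le> \<eta>"
    using supremum assms by (force simp: is_supremum_def)
  then show ?thesis
    using comparable_below[OF assms(1) family_in supremum_in] family_le assms(2)
    by (metis less_le_not_le less_imp_le)
qed

lemma eventually_tails: "i \<in> I \<Longrightarrow> \<forall>\<^sub>F j in tails I r. j \<in> I \<and> (i, j) \<in> r"
  unfolding tails_def by (rule eventually_INF1) (auto simp: eventually_principal)

lemma limitin_supremum: "limitin (weak_tree_topology T) \<nu> \<sigma> (tails I r)"
proof (rule limitin_weak_tree_topologyI)
  show "\<sigma> \<in> T" by (rule supremum_in)
  obtain i where "i \<in> I" using index_order by blast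
  from eventually_tails[OF this] show "\<forall>\<^sub>F j in tails I r. \<nu> j \<in> T"
    by eventually_elim (simp add: family_in)
next
  fix \<eta> \<zeta> assume \<eta>: "\<eta> \<in> T" and \<zeta>: "\<zeta> \<in> T" and *: "\<sigma> \<in> tangent_class T \<eta> \<zeta>"
  let ?m = "meet T \<zeta> \<sigma>"
  have neq: "\<sigma> \<noteq> \<eta>" and int: "\<eta> \<notin> tree_interval T \<zeta> \<sigma>"
    using * by (auto simp: tangent_class_def)
  note m = meet_in[OF \<zeta> supremum_in] meet_le1[OF \<zeta> supremum_in] meet_le2[OF \<zeta> supremum_in]
  show "\<forall>\<^sub>F j in tails I r. \<nu> j \<in> tangent_class T \<eta> \<zeta>"
  proof (cases "\<eta> \<le> \<sigma>")
    case True
    have "\<not> ?m \<le> \<eta>"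
      using int True \<eta> by (auto simp: tree_interval_def)
    then have less: "\<eta> < ?m"
      using comparable_below[OF m(1) \<eta> supremum_in m(3) True] by auto
    obtain i where i: "i \<in> I" "\<eta> < \<nu> i"
      using ex_family_greater[OF \<eta>] True neq by force
    from eventually_tails[OF i(1)] show ?thesis
    proof eventually_elim
      case (elim j)
      have j: "\<nu> j \<in> T" "\<nu> j \<le> \<sigma>" and "\<eta> < \<nu> j"
        using elim i family_mono family_le family_in by (auto intro: less_le_trans)
      \<comment> \<open>\<open>?m\<close> and \<open>\<nu> j\<close> are comparable because both lie
        below \<sigma>. The smaller one is a common lower bound of \<zeta> and
        \<open>\<nu> j\<close>, and it is strictly above \<eta>.\<close>
      have "\<not> meet T \<zeta> (\<nu> j) \<le> \<eta>"
      proof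
        assume le: "meet T \<zeta> (\<nu> j) \<le> \<eta>"
        from comparable_below[OF m(1) j(1) supremum_in m(3) j(2)]
        show False
        proof
          assume "?m \<le> \<nu> j"
          then have "?m \<le> meet T \<zeta> (\<nu> j)" using m j \<zeta> by (intro meet_greatest) auto
          then show False using le less by (meson leD order_trans)
        next
          assume "\<nu> j \<le> ?m"
          then have "\<nu> j \<le> meet T \<zeta> (\<nu> j)" using m j \<zeta> by (intro meet_greatest) auto
          then show False using le \<open>\<eta> < \<nu> j\<close> by (meson leD order_trans)
        qed
      qed
      then show ?case
        using j \<open>\<eta> < \<nu> j\<close> by (auto simp: tangent_class_def tree_interval_def)
    qed
  next
    case False
    obtain i where "i \<in> I" using index_order by blast
    from eventually_tails[OF this] show ?thesis
    proof eventually_elim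
      case (elim j)
      have j: "\<nu> j \<in> T" "\<nu> j \<le> \<sigma>"
        using elim family_le family_in by auto
      \<comment> \<open>Not being below \<sigma>, \<eta> is not below \<open>\<nu> j\<close> either,
        so it could only lie on the branch towards \<zeta>. There, comparison with \<open>?m\<close>
        would put it on the interval to \<sigma> or below \<sigma>.\<close>
      have "\<not> \<eta> \<le> \<zeta>" if le: "meet T \<zeta> (\<nu> j) \<le> \<eta>"
      proof
        assume "\<eta> \<le> \<zeta>"
        then have "\<not> ?m \<le> \<eta>"
          using int \<eta> by (auto simp: tree_interval_def)
        then have "\<eta> \<le> ?m"
          using comparable_below[OF m(1) \<eta> \<zeta> m(2) \<open>\<eta> \<le> \<zeta>\<close>] by auto
        then show False using False m(3) by (meson order_trans)
      qed
      then show ?case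
        using j False by (auto simp: tangent_class_def tree_interval_def)
    qed
  qed
qed

lemma limitin_imp_eq_supremum:
  assumes lim: "limitin (weak_tree_topology T) \<nu> z (tails I r)"
  shows "z = \<sigma>"
proof (rule ccontr)
  assume neq: "z \<noteq> \<sigma>"
  have z: "z \<in> T"
    using lim by (simp add: limitin_def topspace_weak_tree_topology)
  \<comment> \<open>Removing a point \<eta> that lies on every interval from \<open>z\<close> to a
    tail of the family leaves \<open>z\<close> and that tail in different classes.\<close>
  have "\<exists>\<eta>\<in>T. \<eta> \<noteq> z \<and> (\<exists>i\<in>I. \<forall>j\<in>I. (i, j) \<in> r \<longrightarrow> \<eta> \<in> tree_interval T z (\<nu> j))"
  proof (cases "\<sigma> \<le> z")
    case True
    have "\<sigma> \<in> tree_interval T z (\<nu> j)" if "j \<in> I" for j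
    proof -
      have "meet T z (\<nu> j) \<le> \<sigma>"
        using meet_le2[OF z family_in[OF that]] family_le[OF that] by simp
      then show ?thesis using True supremum_in by (auto simp: tree_interval_def)
    qed
    then show ?thesis
      using supremum_in neq index_order(1) by (metis ex_in_conv)
  next
    case False
    let ?m = "meet T z \<sigma>"
    note m = meet_in[OF z supremum_in] meet_le1[OF z supremum_in] meet_le2[OF z supremum_in]
    have "?m < \<sigma>"
      using False m by (metis order_neq_le_trans)
    then obtain i where i: "i \<in> I" "?m < \<nu> i"
      using ex_family_greater m(1) by blast
    \<comment> \<open>If they were equal, \<open>z\<close> would be below \<sigma>, so
      \<open>\<nu> i\<close> would be below \<open>?m\<close>.\<close>
    have "\<nu> i \<noteq> z"
      using i meet_greatest[OF z supremum_in family_in] family_le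
      by (metis leD order_refl)
    moreover have "\<nu> i \<in> tree_interval T z (\<nu> j)" if j: "j \<in> I" "(i, j) \<in> r" for j
    proof -
      note mj = family_in[OF j(1)]
      have "meet T z (\<nu> j) \<le> ?m"
        using meet_in[OF z mj] meet_le1[OF z mj] meet_le2[OF z mj] family_le[OF j(1)]
        by (intro meet_greatest z supremum_in) auto
      then have "meet T z (\<nu> j) \<le> \<nu> i" using i(2) by simp
      then show ?thesis
        using family_mono[OF i(1) j] family_in[OF i(1)] by (simp add: tree_interval_def)
    qed
    ultimately show ?thesis
      using i(1) family_in by blast
  qed
  then obtain \<eta> i where \<eta>: "\<eta> \<in> T" "\<eta> \<noteq> z" and i: "i \<in> I"
    and int: "\<And>j. \<lbrakk>j \<in> I; (i, j) \<in> r\<rbrakk> \<Longrightarrow> \<eta> \<in> tree_interval T z (\<nu> j)"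
    by blast
  have "openin (weak_tree_topology T) (tangent_class T \<eta> z)" "z \<in> tangent_class T \<eta> z"
    using \<eta> z by (auto intro: openin_tangent_class tangent_class_self)
  then obtain k where k: "k \<in> I" "\<And>j. \<lbrakk>j \<in> I; (k, j) \<in> r\<rbrakk> \<Longrightarrow> \<nu> j \<in> tangent_class T \<eta> z"
    using lim unfolding limitin_tails_iff[OF index_order] by blast
  have "refl_on I r" "total_on I r"
    using index_order(2) by (auto simp: order_on_defs)
  then have "\<exists>j\<in>I. (i, j) \<in> r \<and> (k, j) \<in> r"
    using i k(1) by (metis refl_onD total_on_def)
  then show False
    using int k(2) by (fastforce simp: tangent_class_def)
qed

lemma is_unique_limit_supremum: "is_unique_limit (weak_tree_topology T) I r \<nu> \<sigma>"
  unfolding is_unique_limit_def using limitin_supremum limitin_imp_eq_supremum by blast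

end

section \<open>Valuations on polynomials\<close>

instance top :: (linordered_ab_group_add) ordered_comm_monoid_add
  by standard (auto simp: plus_top_def split: top.splits)

lemma
  fixes x y z :: "'l::linordered_ab_group_add top"
  shows top_min_add_distrib_left: "min x y + z = min (x + z) (y + z)"
    and top_min_add_distrib_right: "z + min x y = min (z + x) (z + y)"
  using add_left_mono[of x y z] add_left_mono[of y x z]
  by (auto simp: min_def add.commute)

lemma add_Top [simp]: "top.Top + x = top.Top" "x + top.Top = top.Top"
  by (auto simp: plus_top_def split: top.splits)

lemma min_Top [simp]:
  fixes x :: "'a::linorder top"
  shows "min top.Top x = x" "min x top.Top = x"
  by (simp_all add: min_absorb1 min_absorb2)

text \<open>Infinity is absorbing, so strictness survives only the addition of a finite
  \<open>c\<close>. This is why polynomials of infinite value need separate arguments below.\<close>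

lemma top_add_strict_left_mono:
  fixes a b c :: "'l::linordered_ab_group_add top"
  assumes "a < b" "c \<noteq> top.Top"
  shows "c + a < c + b"
  using assms by (cases a; cases b; cases c) (auto simp: plus_top_def)

text \<open>An ordered group has no 2-torsion. Since -1 squares to 1, this forces every valuation to
  vanish at -1.\<close>

lemma top_add_self_eq_0_iff:
  fixes a :: "'l::linordered_ab_group_add top"
  shows "a + a = 0 \<longleftrightarrow> a = 0"
  by (cases a) (auto simp: plus_top_def zero_top_def)

section \<open>Basic rules for valuations\<close>

lemma
  assumes "valuation \<nu>"
  shows valuation_mult: "\<nu> (f * g) = \<nu> f + \<nu> g"
    and valuation_add: "min (\<nu> f) (\<nu> g) \<le> \<nu> (f + g)"
    and valuation_one: "\<nu> 1 = 0"
    and valuation_zero: "\<nu> 0 = top.Top"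
  using assms by (auto simp: valuation_def)

lemma valuation_minus:
  assumes "valuation \<nu>"
  shows "\<nu> (- f) = \<nu> f"
proof -
  have "\<nu> (-1) + \<nu> (-1) = 0"
    using valuation_mult[OF assms, of "-1" "-1"] valuation_one[OF assms] by simp
  then have "\<nu> (-1) = 0"
    by (simp only: top_add_self_eq_0_iff)
  then show ?thesis
    using valuation_mult[OF assms, of "-1" f] by simp
qed

text \<open>Stated for arbitrary functions because it is also applied to truncations before they are
  known to be valuations.\<close>

lemma ultrametric_add_eq_left:
  fixes \<nu> :: "'a::ab_group_add \<Rightarrow> 'b::linorder"
  assumes "\<And>f g. min (\<nu> f) (\<nu> g) \<le> \<nu> (f + g)" "\<And>f. \<nu> (- f) = \<nu> f" "\<nu> f < \<nu> g"
  shows "\<nu> (f + g) = \<nu> f"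
proof (rule antisym)
  have "min (\<nu> (f + g)) (\<nu> g) \<le> \<nu> f"
    using assms(1)[of "f + g" "- g"] by (simp add: assms(2))
  then show "\<nu> (f + g) \<le> \<nu> f"
    using assms(3) by (auto simp: min_le_iff_disj)
  show "\<nu> f \<le> \<nu> (f + g)"
    using assms(1)[of f g] assms(3) by (simp add: min_absorb1)
qed

lemma valuation_add_eq_left:
  "\<lbrakk>valuation \<nu>; \<nu> f < \<nu> g\<rbrakk> \<Longrightarrow> \<nu> (f + g) = \<nu> f"
  by (rule ultrametric_add_eq_left) (simp_all add: valuation_add valuation_minus)

lemma valuation_add_eq_right:
  "\<lbrakk>valuation \<nu>; \<nu> g < \<nu> f\<rbrakk> \<Longrightarrow> \<nu> (f + g) = \<nu> g"
  using valuation_add_eq_left[of \<nu> g f] by (simp add: add.commute)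

text \<open>Induction along the \<phi>-expansion, as in Horner's scheme: the quotient by a
  nonconstant \<phi> has smaller degree.\<close>

lemma poly_division_induct [consumes 1, case_names small division]:
  fixes \<phi> f :: "'k::field poly"
  assumes "0 < degree \<phi>"
    and small: "\<And>r. degree r < degree \<phi> \<Longrightarrow> P r"
    and division: "\<And>q r. \<lbrakk>P q; degree r < degree \<phi>\<rbrakk> \<Longrightarrow> P (q * \<phi> + r)"
  shows "P f"
proof (induction "degree f" arbitrary: f rule: less_induct)
  case less
  show ?case
  proof (cases "degree f < degree \<phi>")
    case False
    have "degree (f mod \<phi>) < degree \<phi>"
      using degree_mod_less[of \<phi> f] assms(1) by fastforce
    moreover have "P (f div \<phi>)"
      using False assms(1) by (intro less degree_div_less) auto
    ultimately have "P (f div \<phi> * \<phi> + f mod \<phi>)" by (intro division)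
    then show ?thesis by simp
  qed (rule small)
qed

lemma poly_division_cases:
  fixes \<phi> f :: "'k::field poly"
  assumes "0 < degree \<phi>"
  obtains q r where "f = q * \<phi> + r" "degree r < degree \<phi>"
proof
  show "f = f div \<phi> * \<phi> + f mod \<phi>" by simp
  show "degree (f mod \<phi>) < degree \<phi>"
    using degree_mod_less[of \<phi> f] assms by fastforce
qed

text \<open>Cancellation is conceivable only if both summands have the same \<mu>-value. In that
  case the jump from \<open>\<mu> \<phi>\<close> to \<open>\<nu> \<phi>\<close> makes
  \<open>r\<close> dominate under \<nu>, so the \<nu>-value of the sum is \<open>\<mu> r\<close>,
  and this bounds its \<mu>-value from above.\<close>

lemma valuation_division_eq_min:
  assumes "valuation \<mu>" "valuation \<nu>" "\<mu> \<le> \<nu>" "\<mu> \<phi> < \<nu> \<phi>" "\<mu> r = \<nu> r"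
  shows "\<mu> (q * \<phi> + r) = min (\<mu> q + \<mu> \<phi>) (\<mu> r)"
proof (cases "\<mu> (q * \<phi>) = \<mu> r")
  case True
  have "\<mu> (q * \<phi> + r) \<le> \<mu> r"
  proof (rule ccontr)
    assume "\<not> ?thesis"
    then have less: "\<mu> r < \<mu> (q * \<phi> + r)" by simp
    \<comment> \<open>The strict inequality makes \<open>\<mu> r\<close> finite, and
      \<open>\<mu> r\<close> equals \<open>\<mu> q + \<mu> \<phi>\<close>.\<close>
    then have "\<mu> q \<noteq> top.Top"
      using True by (auto simp: valuation_mult[OF assms(1)])
    then have "\<mu> q + \<mu> \<phi> < \<mu> q + \<nu> \<phi>"
      using assms(4) by (rule top_add_strict_left_mono[rotated])
    also have "\<dots> \<le> \<nu> (q * \<phi>)"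
      using le_funD[OF assms(3)] by (auto simp: valuation_mult[OF assms(2)] intro: add_right_mono)
    finally have "\<nu> r < \<nu> (q * \<phi>)"
      using True assms(5) by (simp add: valuation_mult[OF assms(1)])
    then have "\<nu> (q * \<phi> + r) = \<mu> r"
      using assms by (simp add: valuation_add_eq_right)
    then show False
      using less le_funD[OF assms(3), of "q * \<phi> + r"] by simp
  qed
  then show ?thesis
    using True valuation_add[OF assms(1), of "q * \<phi>" r]
    by (auto simp: valuation_mult[OF assms(1)])
next
  case False
  then consider "\<mu> (q * \<phi>) < \<mu> r" | "\<mu> r < \<mu> (q * \<phi>)" by fastforce
  then show ?thesis
    by cases (simp_all add: valuation_add_eq_left valuation_add_eq_right min_absorb1 min_absorb2 assms(1)
        flip: valuation_mult[OF assms(1)])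
qed

text \<open>Along the \<phi>-expansion \<mu> is exactly a minimum, whereas \<eta> is at least the
  corresponding minimum by the ultrametric inequality.\<close>

lemma valuation_le_if_le_divisor:
  fixes \<mu> :: "'k::field poly \<Rightarrow> 'l::linordered_ab_group_add top"
  assumes "valuation \<mu>" "valuation \<nu>" "valuation \<eta>" "\<mu> \<le> \<nu>" "\<mu> \<phi> < \<nu> \<phi>" "0 < degree \<phi>"
    and "\<And>r. degree r < degree \<phi> \<Longrightarrow> \<mu> r = \<nu> r"
    and "\<And>r. degree r < degree \<phi> \<Longrightarrow> \<mu> r \<le> \<eta> r"
    and "\<mu> \<phi> \<le> \<eta> \<phi>"
  shows "\<mu> \<le> \<eta>"
proof (rule le_funI)
  fix f
  from \<open>0 < degree \<phi>\<close> show "\<mu> f \<le> \<eta> f"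
  proof (induction f rule: poly_division_induct)
    case (small r)
    then show ?case by (rule assms(8))
  next
    case (division q r)
    have "\<mu> (q * \<phi> + r) = min (\<mu> q + \<mu> \<phi>) (\<mu> r)"
      using division assms by (intro valuation_division_eq_min) auto
    also have "\<dots> \<le> min (\<eta> (q * \<phi>)) (\<eta> r)"
      using division assms(8,9) by (intro min.mono) (auto simp: valuation_mult[OF assms(3)] intro: add_mono)
    also have "\<dots> \<le> \<eta> (q * \<phi> + r)"
      by (rule valuation_add[OF assms(3)])
    finally show ?case .
  qed
qed

section \<open>Comparability below a common upper bound\<close>

lemma val_tree_const:
  assumes "\<mu> \<in> val_tree v" "\<nu> \<in> val_tree v" "degree f = 0"
  shows "\<mu> f = \<nu> f"
  using assms by (auto simp: val_tree_def elim!: degree_eq_zeroE)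

lemma val_tree_first_difference:
  assumes "\<mu> \<in> val_tree v" "\<nu> \<in> val_tree v" "\<mu> \<noteq> \<nu>"
  obtains \<phi> where "\<mu> \<phi> \<noteq> \<nu> \<phi>" "0 < degree \<phi>" "\<And>r. degree r < degree \<phi> \<Longrightarrow> \<mu> r = \<nu> r"
proof -
  obtain g where "\<mu> g \<noteq> \<nu> g" using assms(3) by blast
  then obtain \<phi> where \<phi>: "\<mu> \<phi> \<noteq> \<nu> \<phi>" "\<And>r. \<mu> r \<noteq> \<nu> r \<Longrightarrow> degree \<phi> \<le> degree r"
    using ex_has_least_nat[of "\<lambda>f. \<mu> f \<noteq> \<nu> f" g degree] by blast
  moreover have "0 < degree \<phi>"
    using val_tree_const[OF assms(1,2), of \<phi>] \<phi>(1) by auto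
  ultimately show thesis
    using that by (metis leD)
qed

text \<open>Let \<phi> and \<psi> be first differences of \<mu> and \<eta> from \<nu>. Below the
  smaller of their degrees all three valuations agree, so one comparison at the polynomial of
  smaller degree decides the order.\<close>

lemma val_tree_comparable_below:
  assumes T: "\<mu> \<in> val_tree v" "\<eta> \<in> val_tree v" "\<nu> \<in> val_tree v" and "\<mu> \<le> \<nu>" "\<eta> \<le> \<nu>"
  shows "\<mu> \<le> \<eta> \<or> \<eta> \<le> \<mu>"
proof (cases "\<mu> = \<nu> \<or> \<eta> = \<nu>")
  case True
  then show ?thesis using assms by auto
next
  case False
  have val: "valuation \<mu>" "valuation \<eta>" "valuation \<nu>"
    using T by (auto simp: val_tree_def)
  obtain \<phi> where \<phi>: "\<mu> \<phi> \<noteq> \<nu> \<phi>" "0 < degree \<phi>" "\<And>r. degree r < degree \<phi> \<Longrightarrow> \<mu> r = \<nu> r"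
    using val_tree_first_difference[OF T(1,3)] False by blast
  obtain \<psi> where \<psi>: "\<eta> \<psi> \<noteq> \<nu> \<psi>" "0 < degree \<psi>" "\<And>r. degree r < degree \<psi> \<Longrightarrow> \<eta> r = \<nu> r"
    using val_tree_first_difference[OF T(2,3)] False by blast
  have le: "\<mu> f \<le> \<nu> f" "\<eta> f \<le> \<nu> f" for f
    using assms(4,5) by (auto dest: le_funD)
  have less: "\<mu> \<phi> < \<nu> \<phi>" "\<eta> \<psi> < \<nu> \<psi>"
    using \<phi>(1) \<psi>(1) le by (auto simp: order_less_le)
  show ?thesis
  proof (cases "degree \<phi> \<le> degree \<psi> \<and> \<mu> \<phi> \<le> \<eta> \<phi> \<or> degree \<psi> \<le> degree \<phi> \<and> \<eta> \<psi> \<le> \<mu> \<psi>")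
    case True
    then show ?thesis
    proof
      assume "degree \<phi> \<le> degree \<psi> \<and> \<mu> \<phi> \<le> \<eta> \<phi>"
      then have "\<mu> \<le> \<eta>"
        using \<phi> \<psi>(3) le by (intro valuation_le_if_le_divisor[OF val(1,3,2) assms(4) less(1)]) auto
      then show ?thesis ..
    next
      assume "degree \<psi> \<le> degree \<phi> \<and> \<eta> \<psi> \<le> \<mu> \<psi>"
      then have "\<eta> \<le> \<mu>"
        using \<psi> \<phi>(3) le by (intro valuation_le_if_le_divisor[OF val(2,3,1) assms(5) less(2)]) auto
      then show ?thesis ..
    qed
  next
    case False
    \<comment> \<open>If \<phi> had smaller degree, then \<eta> would agree with \<nu> at \<phi> and
      the first alternative would hold; the other case is symmetric.\<close>
    have eq: "degree \<phi> = degree \<psi>"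
    proof (rule ccontr)
      assume "degree \<phi> \<noteq> degree \<psi>"
      then consider "degree \<phi> < degree \<psi>" | "degree \<psi> < degree \<phi>" by linarith
      then show False
        by cases (use False \<phi>(3) \<psi>(3) le in force)+
    qed
    then have "\<eta> \<phi> < \<mu> \<phi>" using False by auto
    \<comment> \<open>\<phi> also serves as a first difference of \<eta> from \<nu>: it has the
      degree of \<psi>, and \<open>\<eta> \<phi> < \<mu> \<phi> < \<nu> \<phi>\<close>.\<close>
    then have "\<eta> \<le> \<mu>"
      using eq \<phi> \<psi> less by (intro valuation_le_if_le_divisor[OF val(2,3,1) assms(5), of \<phi>]) auto
    then show ?thesis ..
  qed
qed

section \<open>Truncation and infima\<close>

text \<open>
  If \<open>f = \<Sum>s. f\<^sub>s \<phi>\<^sup>s\<close> is the \<open>\<phi>\<close>-expansion of \<open>f\<close>, this is the minimum of the \<open>\<mu> f\<^sub>s + s \<gamma>\<close>.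
\<close>

function truncation ::
    "('k::field poly \<Rightarrow> 'l::linordered_ab_group_add top) \<Rightarrow> 'k poly \<Rightarrow> 'l top \<Rightarrow> 'k poly \<Rightarrow> 'l top" where
  "truncation \<mu> \<phi> \<gamma> f =
     (if degree f < degree \<phi> \<or> degree \<phi> = 0 then \<mu> f
      else min (truncation \<mu> \<phi> \<gamma> (f div \<phi>) + \<gamma>) (\<mu> (f mod \<phi>)))"
  by pat_completeness auto
termination
  \<comment> \<open>The guard \<open>degree \<phi> = 0\<close> excludes divisions that need not
    lower the degree.\<close>
  by (relation "Wellfounded.measure (\<lambda>(\<mu>, \<phi>, \<gamma>, f). degree f)") (auto intro!: degree_div_less)

declare truncation.simps [simp del]

section \<open>The truncation attached to a first difference\<close>

locale diverging_valuations =
  fixes \<mu> \<nu> :: "'k::field poly \<Rightarrow> 'l::linordered_ab_group_add top" and \<phi> :: "'k poly"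
  assumes val1: "valuation \<mu>" and val2: "valuation \<nu>"
    and degree_pos: "0 < degree \<phi>"
    and less: "\<nu> \<phi> < \<mu> \<phi>"
    and agree: "\<And>r. degree r < degree \<phi> \<Longrightarrow> \<mu> r = \<nu> r"
begin

abbreviation \<omega> :: "'k poly \<Rightarrow> 'l top" where
  "\<omega> \<equiv> truncation \<mu> \<phi> (\<nu> \<phi>)"

lemma truncation_small: "degree r < degree \<phi> \<Longrightarrow> \<omega> r = \<mu> r"
  by (simp add: truncation.simps)

lemma truncation_division:
  assumes "degree r < degree \<phi>"
  shows "\<omega> (q * \<phi> + r) = min (\<omega> q + \<nu> \<phi>) (\<mu> r)"
proof (cases "q = 0")
  \<comment> \<open>Here the sum is \<open>r\<close> itself and the non-recursive branch applies;
    the formula still holds because 0 has infinite value.\<close>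
  case True
  then show ?thesis
    using assms degree_pos by (simp add: truncation_small valuation_zero[OF val1])
next
  case False
  have "\<phi> \<noteq> 0" using degree_pos by auto
  have "degree (q * \<phi> + r) = degree (q * \<phi>)"
    using assms False \<open>\<phi> \<noteq> 0\<close> by (intro degree_add_eq_left) (simp add: degree_mult_eq)
  then have "\<not> degree (q * \<phi> + r) < degree \<phi>"
    using False \<open>\<phi> \<noteq> 0\<close> by (simp add: degree_mult_eq)
  moreover have "(q * \<phi> + r) div \<phi> = q" "(q * \<phi> + r) mod \<phi> = r"
    using assms \<open>\<phi> \<noteq> 0\<close> by (simp_all add: div_poly_less mod_poly_less)
  ultimately show ?thesis
    using degree_pos by (subst truncation.simps) simp
qed

lemma truncation_mult_divisor: "\<omega> (q * \<phi>) = \<omega> q + \<nu> \<phi>"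
  using truncation_division[of 0 q] degree_pos by (simp add: valuation_zero[OF val1])

text \<open>\<eta> is kept general so that both \<mu> and \<nu> can be inserted for it.\<close>

lemma truncation_le:
  assumes "valuation \<eta>" "\<nu> \<phi> \<le> \<eta> \<phi>" "\<And>r. degree r < degree \<phi> \<Longrightarrow> \<mu> r = \<eta> r"
  shows "\<omega> \<le> \<eta>"
proof (rule le_funI)
  fix f
  from degree_pos show "\<omega> f \<le> \<eta> f"
  proof (induction f rule: poly_division_induct)
    case (small r)
    then show ?case using assms(3) by (simp add: truncation_small)
  next
    case (division q r)
    have "\<omega> (q * \<phi> + r) \<le> min (\<eta> (q * \<phi>)) (\<eta> r)"
      unfolding truncation_division[OF division(2)]
      using division assms by (intro min.mono) (auto simp: valuation_mult[OF assms(1)] intro: add_mono)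
    also have "\<dots> \<le> \<eta> (q * \<phi> + r)"
      by (rule valuation_add[OF assms(1)])
    finally show ?case .
  qed
qed

lemma truncation_le1: "\<omega> \<le> \<mu>"
  using less by (intro truncation_le val1) auto

lemma truncation_le2: "\<omega> \<le> \<nu>"
  using agree by (intro truncation_le val2) auto

text \<open>Adding \<phi>-expansions produces no carries, so the inequality can be checked
  coefficient by coefficient.\<close>

lemma truncation_add: "min (\<omega> f) (\<omega> g) \<le> \<omega> (f + g)"
  using degree_pos
proof (induction f arbitrary: g rule: poly_division_induct)
  case (small r)
  obtain p s where g: "g = p * \<phi> + s" "degree s < degree \<phi>"
    using poly_division_cases[OF degree_pos] by blast
  have "r + g = p * \<phi> + (r + s)" by (simp add: g)
  then have "\<omega> (r + g) = min (\<omega> p + \<nu> \<phi>) (\<mu> (r + s))"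
    using small g(2) by (simp only: truncation_division degree_add_less)
  moreover have "\<omega> g = min (\<omega> p + \<nu> \<phi>) (\<mu> s)"
    using g by (simp only: truncation_division)
  ultimately show ?case
    using valuation_add[OF val1, of r s] by (auto simp: truncation_small[OF small] min_le_iff_disj)
next
  case (division q r)
  obtain p s where g: "g = p * \<phi> + s" "degree s < degree \<phi>"
    using poly_division_cases[OF degree_pos] by blast
  have "q * \<phi> + r + g = (q + p) * \<phi> + (r + s)" by (simp add: g algebra_simps)
  then have "\<omega> (q * \<phi> + r + g) = min (\<omega> (q + p) + \<nu> \<phi>) (\<mu> (r + s))"
    using division(2) g(2) by (simp only: truncation_division degree_add_less)
  moreover have "\<omega> g = min (\<omega> p + \<nu> \<phi>) (\<mu> s)"
    using g by (simp only: truncation_division)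
  moreover have "min (\<omega> q + \<nu> \<phi>) (\<omega> p + \<nu> \<phi>) \<le> \<omega> (q + p) + \<nu> \<phi>"
    using add_right_mono[OF division(1)[of p], of "\<nu> \<phi>"] by (simp add: top_min_add_distrib_left)
  ultimately show ?case
    using valuation_add[OF val1, of r s] by (auto simp: truncation_division[OF division(2)] min_le_iff_disj)
qed

section \<open>Multiplicativity of the truncation\<close>

text \<open>
  The product \<open>a b\<close> has the same value under \<open>\<mu>\<close> and \<open>\<nu>\<close>, which rules out that \<open>c \<phi>\<close>, whose values differ,
  determines it.
\<close>

lemma small_mult:
  assumes "degree a < degree \<phi>" "degree b < degree \<phi>"
    and ab: "a * b = c * \<phi> + t" and t: "degree t < degree \<phi>"
  shows "\<mu> t = \<mu> a + \<mu> b" "\<mu> t \<le> \<mu> c + \<nu> \<phi>" "\<omega> c = \<mu> c"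
proof -
  have "\<phi> \<noteq> 0" using degree_pos by auto
  \<comment> \<open>The product has degree below twice that of \<phi>, so its quotient by \<phi> is
    again small, and \<mu> and \<nu> agree on it.\<close>
  have c: "degree c < degree \<phi>"
  proof (cases "c = 0")
    case False
    have "degree (a * b) < degree \<phi> + degree \<phi>"
      using degree_mult_le[of a b] assms(1,2) by linarith
    then have "degree (a * b - t) < degree \<phi> + degree \<phi>"
      using t by (intro degree_diff_less) auto
    then show ?thesis
      using False \<open>\<phi> \<noteq> 0\<close> by (simp add: ab degree_mult_eq)
  qed (use degree_pos in simp)
  then show "\<omega> c = \<mu> c" by (rule truncation_small)
  have ab_eq: "\<mu> (a * b) = \<nu> (a * b)"
    using assms(1,2) by (simp only: valuation_mult[OF val1] valuation_mult[OF val2] agree)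
  \<comment> \<open>Otherwise \<open>\<nu> (a * b)\<close> would be
    \<open>\<nu> (c * \<phi>)\<close>, which is smaller than both \<open>\<mu> (c * \<phi>)\<close>
    and \<open>\<mu> t\<close>, hence smaller than \<open>\<mu> (a * b)\<close>.\<close>
  have le: "\<nu> t \<le> \<nu> (c * \<phi>)"
  proof (rule ccontr)
    assume "\<not> ?thesis"
    then have *: "\<nu> (c * \<phi>) < \<nu> t" by simp
    then have "\<mu> c \<noteq> top.Top"
      using agree[OF c] by (auto simp: valuation_mult[OF val2])
    then have "\<nu> (c * \<phi>) < \<mu> (c * \<phi>)"
      using less agree[OF c] by (simp add: valuation_mult[OF val1] valuation_mult[OF val2] top_add_strict_left_mono)
    moreover have "\<nu> (a * b) = \<nu> (c * \<phi>)"
      unfolding ab using * by (rule valuation_add_eq_left[OF val2])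
    moreover have "min (\<mu> (c * \<phi>)) (\<mu> t) \<le> \<mu> (a * b)"
      unfolding ab by (rule valuation_add[OF val1])
    ultimately show False
      using * ab_eq agree[OF t] by (auto simp: min_le_iff_disj)
  qed
  then show le': "\<mu> t \<le> \<mu> c + \<nu> \<phi>"
    by (simp add: agree t c valuation_mult[OF val2])
  \<comment> \<open>For finite \<open>\<mu> c\<close> the passage from \<open>\<nu> \<phi>\<close>
    to \<open>\<mu> \<phi>\<close> makes \<open>t\<close> strictly dominant. Otherwise both summands
    have infinite value.\<close>
  have "\<mu> (c * \<phi> + t) = \<mu> t"
  proof (cases "\<mu> t < \<mu> (c * \<phi>)")
    case True
    then show ?thesis by (rule valuation_add_eq_right[OF val1])
  next
    case False
    have "\<mu> c = top.Top"
    proof (rule ccontr)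
      assume "\<mu> c \<noteq> top.Top"
      then have "\<mu> c + \<nu> \<phi> < \<mu> (c * \<phi>)"
        using less by (simp add: valuation_mult[OF val1] top_add_strict_left_mono)
      then show False using False le' by simp
    qed
    then have "\<mu> (c * \<phi>) = top.Top" "\<mu> t = top.Top"
      using False by (auto simp: valuation_mult[OF val1] not_less dest: less_eq_top_is_Top)
    then show ?thesis
      using valuation_add[OF val1, of "c * \<phi>" t] by (auto dest: less_eq_top_is_Top)
  qed
  then show "\<mu> t = \<mu> a + \<mu> b"
    by (simp add: valuation_mult[OF val1] flip: ab)
qed

lemma truncation_small_mult:
  assumes "degree a < degree \<phi>" "degree b < degree \<phi>"
  shows "\<omega> (a * b) = \<mu> a + \<mu> b"
proof -
  obtain c t where ab: "a * b = c * \<phi> + t" "degree t < degree \<phi>"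
    using poly_division_cases[OF degree_pos] by blast
  show ?thesis
    using small_mult[OF assms ab] by (simp add: ab(1) truncation_division[OF ab(2)] min_absorb2)
qed

lemma truncation_minus: "\<omega> (- f) = \<omega> f"
  using degree_pos
proof (induction f rule: poly_division_induct)
  case (small r)
  then show ?case by (simp add: truncation_small valuation_minus[OF val1])
next
  case (division q r)
  have "\<omega> (- q * \<phi> + - r) = \<omega> (q * \<phi> + r)"
    using division truncation_division[of "- r" "- q"] truncation_division[of r q]
    by (simp add: valuation_minus[OF val1])
  then show ?case by simp
qed

lemma truncation_add_eq_left: "\<omega> f < \<omega> g \<Longrightarrow> \<omega> (f + g) = \<omega> f"
  by (rule ultrametric_add_eq_left) (simp_all add: truncation_add truncation_minus)

text \<open>Expanding \<open>g\<close> reduces this to products of two small polynomials, whose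
  value is known. Expanding the other factor then gives the inequality for all products.\<close>

lemma truncation_small_mult_ge:
  assumes "degree r < degree \<phi>"
  shows "\<mu> r + \<omega> g \<le> \<omega> (r * g)"
  using degree_pos
proof (induction g rule: poly_division_induct)
  case (small s)
  then show ?case
    using assms by (simp add: truncation_small truncation_small_mult)
next
  case (division p s)
  have "\<mu> r + \<omega> (p * \<phi> + s) = min (\<mu> r + \<omega> p + \<nu> \<phi>) (\<mu> r + \<mu> s)"
    using division(2) by (simp add: truncation_division top_min_add_distrib_right add.assoc)
  also have "\<dots> \<le> min (\<omega> ((r * p) * \<phi>)) (\<omega> (r * s))"
    using division add_right_mono[OF division(1), of "\<nu> \<phi>"] assms
    by (intro min.mono) (simp_all only: truncation_mult_divisor truncation_small_mult order_refl)
  also have "\<dots> \<le> \<omega> (r * (p * \<phi> + s))"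
    using truncation_add[of "(r * p) * \<phi>" "r * s"] by (simp add: algebra_simps)
  finally show ?case .
qed

lemma truncation_mult_ge: "\<omega> f + \<omega> g \<le> \<omega> (f * g)"
  using degree_pos
proof (induction f rule: poly_division_induct)
  case (small r)
  then show ?case using truncation_small_mult_ge by (simp add: truncation_small)
next
  case (division q r)
  have "\<omega> (q * \<phi> + r) + \<omega> g = min (\<omega> q + \<omega> g + \<nu> \<phi>) (\<mu> r + \<omega> g)"
    unfolding truncation_division[OF division(2)] top_min_add_distrib_left by (simp add: add_ac)
  also have "\<dots> \<le> min (\<omega> ((q * g) * \<phi>)) (\<omega> (r * g))"
    using division add_right_mono[OF division(1), of "\<nu> \<phi>"]
    by (intro min.mono) (simp_all only: truncation_mult_divisor truncation_small_mult_ge)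
  also have "\<dots> \<le> \<omega> ((q * \<phi> + r) * g)"
    using truncation_add[of "(q * g) * \<phi>" "r * g"] by (simp add: algebra_simps)
  finally show ?case .
qed

text \<open>If \<open>\<omega> g\<close> is finite, \<open>r * g\<close> has strictly larger value
  than \<open>q * g * \<phi>\<close> and cannot affect the sum, so multiplicativity for
  \<open>q\<close> carries over.\<close>

lemma truncation_mult_quotient_dominant:
  assumes r: "degree r < degree \<phi>" and dom: "\<omega> q + \<nu> \<phi> < \<mu> r"
    and IH: "\<omega> (q * g) = \<omega> q + \<omega> g"
  shows "\<omega> ((q * \<phi> + r) * g) = \<omega> (q * \<phi> + r) + \<omega> g"
proof (cases "\<omega> g = top.Top")
  case True
  then show ?thesis
    using truncation_mult_ge[of "q * \<phi> + r" g] by (auto dest: less_eq_top_is_Top)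
next
  case False
  have "\<omega> ((q * g) * \<phi>) = \<omega> g + (\<omega> q + \<nu> \<phi>)"
    by (simp add: truncation_mult_divisor IH add_ac)
  also have "\<dots> < \<omega> g + \<mu> r"
    using dom False by (rule top_add_strict_left_mono)
  also have "\<dots> \<le> \<omega> (r * g)"
    using truncation_small_mult_ge[OF r] by (simp add: add.commute)
  finally have "\<omega> ((q * g) * \<phi> + r * g) = \<omega> ((q * g) * \<phi>)"
    by (rule truncation_add_eq_left)
  moreover have "(q * \<phi> + r) * g = (q * g) * \<phi> + r * g"
    by (simp add: algebra_simps)
  moreover have "\<omega> (q * \<phi> + r) = \<omega> q + \<nu> \<phi>"
    using dom by (simp add: truncation_division[OF r] min_absorb1)
  ultimately show ?thesis
    by (simp add: truncation_mult_divisor IH add_ac)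
qed

text \<open>Modulo \<phi> the product has the same remainder as \<open>r * s\<close>, and by
  \<open>small_mult\<close> the value of that remainder is \<open>\<mu> r + \<mu> s\<close>. The
  truncation never exceeds the value of the remainder.\<close>

lemma truncation_mult_remainders_dominant:
  assumes r: "degree r < degree \<phi>" "\<mu> r \<le> \<omega> q + \<nu> \<phi>"
    and s: "degree s < degree \<phi>" "\<mu> s \<le> \<omega> p + \<nu> \<phi>"
  shows "\<omega> ((q * \<phi> + r) * (p * \<phi> + s)) = \<omega> (q * \<phi> + r) + \<omega> (p * \<phi> + s)"
proof (rule antisym)
  obtain c t where rs: "r * s = c * \<phi> + t" "degree t < degree \<phi>"
    using poly_division_cases[OF degree_pos] by blast
  have "(q * \<phi> + r) * (p * \<phi> + s) = (q * p * \<phi> + q * s + r * p + c) * \<phi> + t"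
    using rs(1) by (simp add: algebra_simps)
  then have "\<omega> ((q * \<phi> + r) * (p * \<phi> + s)) \<le> \<mu> t"
    by (simp only: truncation_division[OF rs(2)] min.cobounded2)
  also have "\<dots> = \<mu> r + \<mu> s"
    using small_mult(1)[OF r(1) s(1) rs] .
  finally show "\<omega> ((q * \<phi> + r) * (p * \<phi> + s)) \<le> \<omega> (q * \<phi> + r) + \<omega> (p * \<phi> + s)"
    using r s by (simp add: truncation_division min_absorb2)
qed (rule truncation_mult_ge)

lemma truncation_mult_remainder_dominant:
  assumes r: "degree r < degree \<phi>" "\<mu> r \<le> \<omega> q + \<nu> \<phi>"
  shows "\<omega> ((q * \<phi> + r) * g) = \<omega> (q * \<phi> + r) + \<omega> g"
  using degree_pos
proof (induction g rule: poly_division_induct)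
  case (small s)
  then show ?case
    \<comment> \<open>A small polynomial is a remainder with quotient 0, whose infinite value makes
      the dominance condition trivial.\<close>
    using truncation_mult_remainders_dominant[OF r small, of 0] degree_pos
    by (simp add: truncation_small valuation_zero[OF val1])
next
  case (division p s)
  show ?case
  proof (cases "\<mu> s \<le> \<omega> p + \<nu> \<phi>")
    case True
    then show ?thesis using truncation_mult_remainders_dominant[OF r division(2)] by blast
  next
    case False
    then show ?thesis
      using truncation_mult_quotient_dominant[OF division(2), of p "q * \<phi> + r"] division(1)
      by (simp add: mult.commute add.commute)
  qed
qed

text \<open>Either the quotient part of \<open>f\<close> strictly dominates, where the induction
  hypothesis applies, or the remainder attains the minimum.\<close>

lemma truncation_mult: "\<omega> (f * g) = \<omega> f + \<omega> g"
  using degree_pos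
proof (induction f rule: poly_division_induct)
  case (small r)
  then show ?case
    using truncation_mult_remainder_dominant[OF small, of 0 g] degree_pos
    by (simp add: truncation_small valuation_zero[OF val1])
next
  case (division q r)
  then show ?case
    using truncation_mult_quotient_dominant truncation_mult_remainder_dominant by (meson not_le)
qed

lemma valuation_truncation: "valuation \<omega>"
  using degree_pos unfolding valuation_def
  by (simp add: truncation_mult truncation_add truncation_small valuation_one[OF val1] valuation_zero[OF val1])

end

text \<open>A common lower bound \<eta> is comparable with the truncation, both being below \<mu>.
  If it lies above the truncation, it is squeezed: it agrees with \<mu> in small degree and its
  value at \<phi> is at most \<open>\<nu> \<phi>\<close>, so \<phi> is a first difference of \<eta>
  from \<mu> and \<eta> is also below the truncation.\<close>

lemma val_tree_ex_meet_of_divergence: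
  assumes T: "\<mu> \<in> val_tree v" "\<nu> \<in> val_tree v"
    and \<phi>: "\<nu> \<phi> < \<mu> \<phi>" "0 < degree \<phi>" "\<And>r. degree r < degree \<phi> \<Longrightarrow> \<mu> r = \<nu> r"
  shows "\<exists>\<omega>\<in>val_tree v. \<omega> \<le> \<mu> \<and> \<omega> \<le> \<nu> \<and> (\<forall>\<eta>\<in>val_tree v. \<eta> \<le> \<mu> \<and> \<eta> \<le> \<nu> \<longrightarrow> \<eta> \<le> \<omega>)"
proof -
  interpret diverging_valuations \<mu> \<nu> \<phi>
    using assms by unfold_locales (auto simp: val_tree_def)
  have in_tree: "\<omega> \<in> val_tree v"
    using T(1) degree_pos valuation_truncation by (simp add: val_tree_def truncation_small)
  have \<omega>\<phi>: "\<omega> \<phi> = \<nu> \<phi>"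
    using truncation_mult_divisor[of 1] degree_pos by (simp add: truncation_small valuation_one[OF val1])
  have "\<eta> \<le> \<omega>" if \<eta>: "\<eta> \<in> val_tree v" "\<eta> \<le> \<mu>" "\<eta> \<le> \<nu>" for \<eta>
  proof -
    have "\<eta> \<le> \<omega> \<or> \<omega> \<le> \<eta>"
      using val_tree_comparable_below[OF \<eta>(1) in_tree T(1) \<eta>(2) truncation_le1] .
    then show ?thesis
    proof
      assume "\<omega> \<le> \<eta>"
      have eq: "\<eta> r = \<mu> r" if "degree r < degree \<phi>" for r
        using le_funD[OF \<open>\<omega> \<le> \<eta>\<close>, of r] le_funD[OF \<eta>(2), of r] truncation_small[OF that] by simp
      have "\<eta> \<phi> \<le> \<omega> \<phi>"
        using le_funD[OF \<eta>(3)] \<omega>\<phi> by simp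
      moreover from this have "\<eta> \<phi> < \<mu> \<phi>"
        using less \<omega>\<phi> by simp
      ultimately show "\<eta> \<le> \<omega>"
        using \<eta> degree_pos eq valuation_truncation val1
        by (intro valuation_le_if_le_divisor[of \<eta> \<mu> \<omega> \<phi>]) (auto simp: val_tree_def truncation_small)
    qed
  qed
  then show ?thesis
    using in_tree truncation_le1 truncation_le2 by blast
qed

lemma val_tree_ex_meet:
  assumes T: "\<mu> \<in> val_tree v" "\<nu> \<in> val_tree v"
  shows "\<exists>\<omega>\<in>val_tree v. \<omega> \<le> \<mu> \<and> \<omega> \<le> \<nu> \<and> (\<forall>\<eta>\<in>val_tree v. \<eta> \<le> \<mu> \<and> \<eta> \<le> \<nu> \<longrightarrow> \<eta> \<le> \<omega>)"
proof (cases "\<mu> = \<nu>")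
  case False
  then obtain \<phi> where \<phi>: "\<mu> \<phi> \<noteq> \<nu> \<phi>" "0 < degree \<phi>" "\<And>r. degree r < degree \<phi> \<Longrightarrow> \<mu> r = \<nu> r"
    using val_tree_first_difference[OF T] by blast
  then consider "\<nu> \<phi> < \<mu> \<phi>" | "\<mu> \<phi> < \<nu> \<phi>" by fastforce
  then show ?thesis
  proof cases
    case 1
    with T \<phi> show ?thesis by (intro val_tree_ex_meet_of_divergence)
  next
    case 2
    from val_tree_ex_meet_of_divergence[OF T(2,1) this \<phi>(2)] \<phi>(3) show ?thesis by metis
  qed
qed (use T in blast)

section \<open>The abstract result applied to the tree of valuations\<close>

lemma meet_tree_val_tree: "meet_tree (val_tree v)"
  by standard (rule val_tree_comparable_below val_tree_ex_meet; assumption)+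

theorem proposition6p15:
  fixes v :: "'k::field \<Rightarrow> 'l::linordered_ab_group_add top"
    and I :: "'i set" and r :: "'i rel"
    and \<nu> :: "'i \<Rightarrow> 'k poly \<Rightarrow> 'l top"
    and \<mu> :: "'k poly \<Rightarrow> 'l top"
  assumes "valuation v"
    and "\<exists>H. is_divisible_hull (value_group v) H"
    and "increasing_family (val_tree v) I r \<nu>"
    and "is_supremum (val_tree v) I \<nu> \<mu>"
  shows "is_unique_limit (weak_tree_topology (val_tree v)) I r \<nu> \<mu>"
proof -
  interpret bounded_increasing_family "val_tree v" I r \<nu> \<mu>
    using meet_tree_val_tree assms(3,4)
    by (auto simp: bounded_increasing_family_def bounded_increasing_family_axioms_def)
  show ?thesis by (rule is_unique_limit_supremum)
qed

end
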